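(* Let the functions $\ell_r$ ($r\ge1$), the functions $\Gamma_{y_r}$, the group $\mathcal{G}_r$ of $r$-th roots of unity and the set $G_r=\{\chi\in\mathbb{C}\mid\chi^r=(-1)^{r-1}\}$ be as defined in the context. (1) For every $r\ge1$, $\chi\in\mathcal{G}_r$ and $z\in\mathbb{C}$ with $|z|<1$, one has $\ell_r(z)=\ell_r(\chi z)$ and $e^{\ell_r(z)}=e^{\ell_r(\chi z)}$. In particular, for $r$ even (so that $-1\in\mathcal{G}_r$), these functions are even. (2) For every $r\ge1$ and $|z|<1$, $$\ell_r(z)=-\sum_{\chi\in G_r}\log(\Gamma(1+\chi z))\quad\text{and}\quad e^{\ell_r(z)}=\prod_{\chi\in G_r}e^{\gamma\chi z}\prod_{n\ge1}\Bigl(1+\frac{\chi z}{n}\Bigr)e^{-\chi z/n}.$$ (3) For every odd $r\ge2$ and $|z|<1$, $$\Gamma_{y_r}^{-1}(1+z)=e^{\ell_r(z)}=\Gamma^{-1}(1+z)\prod_{\chi\in G_r\setminus\{1\}}e^{\ell_1(\chi z)}.$$ (4) For every $r\ge2$, odd or even, and $|z|<1$, $$e^{\ell_r(z)}=\prod_{\chi\in G_r}e^{\ell_1(\chi z)}=\prod_{n\ge1}\Bigl(1+\frac{z^r}{n^r}\Bigr).$$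
   Context: $\Gamma$ is the Euler Gamma function, $\zeta$ the Riemann zeta function, $\gamma$ Euler's constant. For $z\in\mathbb{C}$ with $|z|<1$ put $$\ell_1(z):=\gamma z-\sum_{k\ge2}\zeta(k)\frac{(-z)^k}{k},\qquad \ell_r(z):=-\sum_{k\ge1}\zeta(kr)\frac{(-z^r)^k}{k}\ \text{ for } r\ge2.$$ For $k\ge1$ put $\Gamma_{y_k}(1+z):=e^{-\ell_k(z)}$; $\Gamma^{-1}$ and $\Gamma_{y_k}^{-1}$ denote reciprocals, so $\Gamma_{y_k}^{-1}(1+z)=e^{\ell_k(z)}$. For $r\ge1$, $G_r$ is the set of solutions of $z^r=(-1)^{r-1}$ and $\mathcal{G}_r$ is the group of solutions of $z^r=1$. In (2), $\log(\Gamma(1+w))$ for $|w|<1$ denotes the holomorphic branch vanishing at $w=0$. *)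

theory Defs
  imports "HOL-Analysis.Analysis"
begin

text \<open>The Riemann zeta function on its half-plane of absolute convergence \<open>Re s > 1\<close>;
  outside of it the value is meaningless. Only integer arguments \<open>\<ge> 2\<close> are used below.\<close>

definition zeta :: "complex \<Rightarrow> complex" where
  "zeta s = (\<Sum>n. 1 / (of_nat (Suc n)) powr s)"

text \<open>The series starting at \<open>k = 2\<close> and \<open>k = 1\<close>, respectively, are reindexed to start at \<open>0\<close>.
  Meaningful for \<open>r \<ge> 1\<close> and \<open>cmod z < 1\<close>; note that \<open>- z ^ n\<close> is \<open>- (z ^ n)\<close>.\<close>

definition ell :: "nat \<Rightarrow> complex \<Rightarrow> complex" where
  "ell r z =
    (if r = 1
     then euler_mascheroni * z - (\<Sum>k. zeta (of_nat (k + 2)) * ((- z) ^ (k + 2) / of_nat (k + 2)))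
     else - (\<Sum>k. zeta (of_nat ((k + 1) * r)) * ((- (z ^ r)) ^ (k + 1) / of_nat (k + 1))))"

text \<open>The argument is shifted so that \<open>Gamma_y k (1 + z) = exp (- ell k z)\<close>.\<close>

definition Gamma_y :: "nat \<Rightarrow> complex \<Rightarrow> complex" where
  "Gamma_y k w = exp (- ell k (w - 1))"

definition unity_roots :: "nat \<Rightarrow> complex set" where
  "unity_roots r = {\<xi>. \<xi> ^ r = 1}"

definition signed_unity_roots :: "nat \<Rightarrow> complex set" where
  "signed_unity_roots r = {\<xi>. \<xi> ^ r = (- 1) ^ (r - 1)}"

text \<open>The holomorphic branch of \<open>log (Gamma (1 + w))\<close> on the unit disc that vanishes at \<open>0\<close>
  is \<open>ln_Gamma (1 + w)\<close>.\<close>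

lemma one_plus_notin_nonpos_Reals:
  assumes "cmod w < 1"
  shows "1 + w \<notin> \<real>\<^sub>\<le>\<^sub>0"
proof
  assume "1 + w \<in> \<real>\<^sub>\<le>\<^sub>0"
  then have "Re w \<le> -1"
    by (simp add: complex_nonpos_Reals_iff)
  then show False
    using abs_Re_le_cmod[of w] assms by linarith
qed

lemma ln_Gamma_branch:
  "(\<lambda>w::complex. ln_Gamma (1 + w)) holomorphic_on ball 0 1"
  "\<And>w::complex. w \<in> ball 0 1 \<Longrightarrow> exp (ln_Gamma (1 + w)) = Gamma (1 + w)"
  "ln_Gamma (1 + (0::complex)) = 0"
proof -
  have *: "(\<lambda>w::complex. 1 + w) ` ball 0 1 \<inter> \<real>\<^sub>\<le>\<^sub>0 = {}"
    using one_plus_notin_nonpos_Reals by (auto simp del: image_add_ball)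
  have "ln_Gamma \<circ> (\<lambda>w::complex. 1 + w) holomorphic_on ball 0 1"
    by (rule holomorphic_on_compose[OF _ holomorphic_ln_Gamma[OF *]]) (intro holomorphic_intros)
  then show "(\<lambda>w::complex. ln_Gamma (1 + w)) holomorphic_on ball 0 1"
    by (simp add: o_def)
  show "exp (ln_Gamma (1 + w)) = Gamma (1 + w)" if "w \<in> ball 0 1" for w :: complex
  proof -
    have "1 + w \<notin> \<int>\<^sub>\<le>\<^sub>0"
      using one_plus_notin_nonpos_Reals[of w] nonpos_Ints_subset_nonpos_Reals that by auto
    then show ?thesis
      by (simp add: Gamma_complex_altdef)
  qed
  show "ln_Gamma (1 + (0::complex)) = 0"
    using ln_Gamma_complex_conv_fact[of 1] by simp
qed

lemma ln_Gamma_branch_unique: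
  assumes hol: "f holomorphic_on ball 0 1"
    and exp: "\<And>w. w \<in> ball 0 1 \<Longrightarrow> exp (f w) = Gamma (1 + w)"
    and zero: "f 0 = 0"
    and w: "w \<in> ball 0 1"
  shows "f w = ln_Gamma (1 + w)"
proof -
  define g where "g w = f w - ln_Gamma (1 + w)" for w
  have cont: "continuous_on (ball 0 1) g"
    unfolding g_def
    by (intro continuous_on_diff holomorphic_on_imp_continuous_on hol ln_Gamma_branch)
  have int: "\<exists>n::int. g x = of_int (2 * n) * pi * \<i>" if "x \<in> ball 0 1" for x
  proof -
    have "exp (f x) = exp (ln_Gamma (1 + x))"
      using exp ln_Gamma_branch(2) that by simp
    then obtain n :: int where "f x = ln_Gamma (1 + x) + of_int (2 * n) * pi * \<i>"
      by (auto simp: exp_eq)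
    then show ?thesis
      by (auto simp: g_def)
  qed
  have "g constant_on ball 0 1"
  proof (rule continuous_discrete_range_constant[OF _ cont])
    fix x :: complex assume x: "x \<in> ball 0 1"
    have "2 * pi \<le> norm (g y - g x)" if y: "y \<in> ball 0 1" "g y \<noteq> g x" for y
    proof -
      obtain m n :: int where mn: "g x = of_int (2 * m) * pi * \<i>" "g y = of_int (2 * n) * pi * \<i>"
        using int x y by meson
      then have ne: "n \<noteq> m"
        using y by auto
      have "g y - g x = of_real (2 * pi * of_int (n - m)) * \<i>"
        by (simp add: mn algebra_simps)
      then have "norm (g y - g x) = 2 * pi * \<bar>of_int (n - m)\<bar>"
        by (simp only: norm_mult norm_of_real norm_ii) (simp add: abs_mult)
      moreover have "(1::real) \<le> \<bar>of_int (n - m)\<bar>"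
        using ne by linarith
      ultimately show ?thesis
        by simp
    qed
    then show "\<exists>e>0. \<forall>y. y \<in> ball 0 1 \<and> g y \<noteq> g x \<longrightarrow> e \<le> norm (g y - g x)"
      by (intro exI[of _ "2 * pi"]) auto
  qed simp
  then have "g w = g 0"
    using w by (auto simp: constant_on_def)
  then show ?thesis
    using zero ln_Gamma_branch(3) by (simp add: g_def)
qed

end

theory Submission
  imports Defs "HOL-Computational_Algebra.Fundamental_Theorem_Algebra"
begin

text \<open>Inserting \<open>zeta s = (\<Sum>n. 1 / n ^ s)\<close> and exchanging the two absolutely convergent sums gives
  \<open>ell r z = (\<Sum>n. ln (1 + (z / n) ^ r))\<close> for \<open>r \<ge> 2\<close> and
  \<open>ell 1 z = \<gamma> z + (\<Sum>n. ln (1 + z / n) - z / n) = - ln_Gamma (1 + z)\<close>. The factorization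
  \<open>(\<Prod>\<xi>. 1 + \<xi> w) = 1 + w ^ r\<close> over the signed roots of unity holds on the level of principal
  logarithms in the unit disc, and for \<open>r \<ge> 2\<close> the signed roots sum to \<open>0\<close>, so the linear correction
  terms cancel and \<open>ell r z = (\<Sum>\<xi>. ell 1 (\<xi> z))\<close>. All other claims follow by exponentiating.\<close>

section \<open>Exchange of double series and the zeta coefficients\<close>

text \<open>A product of two summable majorants is summable over all index pairs, so the family is
  absolutely summable and Fubini for \<open>infsum\<close> applies. The rest translates between
  \<open>infsum\<close> and ordered series.\<close>

lemma sums_suminf_swap:
  fixes f :: "nat \<Rightarrow> nat \<Rightarrow> 'a::banach"
  assumes a: "summable a" and b: "summable b"
    and a0: "\<And>m. 0 \<le> a m" and b0: "\<And>n. 0 \<le> b n"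
    and le: "\<And>m n. norm (f m n) \<le> a m * b n"
  shows "(\<lambda>m. \<Sum>n. f m n) sums (\<Sum>n. \<Sum>m. f m n)"
proof -
  have sa: "a summable_on UNIV" and sb: "b summable_on UNIV"
    using summable_nonneg_imp_summable_on a b a0 b0 by blast+
  have "(\<lambda>(m, n). a m * b n) summable_on UNIV \<times> UNIV"
  proof (rule summable_on_SigmaI)
    show "((\<lambda>n. case (m, n) of (m, n) \<Rightarrow> a m * b n) has_sum a m * infsum b UNIV) UNIV" for m
      using has_sum_cmult_right[OF has_sum_infsum[OF sb], of "a m"] by simp
    show "(\<lambda>m. a m * infsum b UNIV) summable_on UNIV"
      using sa by (rule summable_on_cmult_left)
  qed (use a0 b0 in auto)
  then have "(\<lambda>(m, n). f m n) abs_summable_on UNIV \<times> UNIV"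
    by (rule Infinite_Sum.abs_summable_on_comparison_test') (use le in auto)
  then have sf: "(\<lambda>(m, n). f m n) summable_on UNIV \<times> UNIV"
    by (rule Infinite_Sum.abs_summable_summable)
  \<comment> \<open>Absolute convergence identifies the ordered \<open>suminf\<close> with the
    unordered \<open>infsum\<close>; each row and column inherits it from the majorant.\<close>
  have infsum_eq: "infsum g UNIV = suminf g" if "summable (\<lambda>n. norm (g n))" for g :: "nat \<Rightarrow> 'a"
    using norm_summable_imp_has_sum[OF that summable_sums[OF summable_norm_cancel[OF that]]]
    by (rule infsumI)
  have inner1: "infsum (\<lambda>n. f m n) UNIV = (\<Sum>n. f m n)" for m
    by (rule infsum_eq, rule summable_comparison_test'[OF summable_mult[OF b, of "a m"]])
      (use le in auto)
  have inner2: "infsum (\<lambda>m. f m n) UNIV = (\<Sum>m. f m n)" for n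
    by (rule infsum_eq, rule summable_comparison_test'[OF summable_mult2[OF a, of "b n"]])
      (use le in auto)
  have "(\<lambda>m. infsum (\<lambda>n. f m n) UNIV) summable_on UNIV"
    using summable_on_Sigma_banach[OF sf] by simp
  then have o1: "(\<lambda>m. \<Sum>n. f m n) sums infsum (\<lambda>m. infsum (\<lambda>n. f m n) UNIV) UNIV"
    using has_sum_imp_sums[OF has_sum_infsum] by (simp add: inner1)
  have "(\<lambda>(n, m). f m n) summable_on UNIV \<times> UNIV"
    using sf summable_on_swap[of "\<lambda>(m, n). f m n" UNIV UNIV] by (simp add: case_prod_beta)
  then have "(\<lambda>n. infsum (\<lambda>m. f m n) UNIV) summable_on UNIV"
    using summable_on_Sigma_banach[of "\<lambda>n m. f m n" UNIV "\<lambda>_. UNIV"] by simp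
  then have "(\<lambda>n. \<Sum>m. f m n) sums infsum (\<lambda>n. infsum (\<lambda>m. f m n) UNIV) UNIV"
    using has_sum_imp_sums[OF has_sum_infsum] by (simp add: inner2)
  then show ?thesis
    using o1 infsum_swap_banach[OF sf] sums_unique by fastforce
qed

lemma zeta_of_nat: "zeta (of_nat k) = (\<Sum>n. 1 / of_nat (Suc n) ^ k)"
  unfolding zeta_def by (intro suminf_cong) (subst powr_nat', auto simp del: of_nat_Suc)

lemma norm_div_Suc_less_1:
  fixes z :: complex
  assumes "cmod z < 1"
  shows "cmod (z / of_nat (Suc n)) < 1"
proof -
  note assms
  also have "1 \<le> real (Suc n)"
    by simp
  finally show ?thesis
    by (simp add: norm_divide divide_simps del: of_nat_Suc)
qed

text \<open>One statement serves both cases of \<open>ell\<close>: \<open>m = 2\<close>,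
  \<open>r = 1\<close> for \<open>ell 1\<close>, and \<open>m = 1\<close> for
  \<open>r \<ge> 2\<close>. The condition \<open>2 \<le> m * r\<close> keeps every zeta argument at
  least 2, inside the half-plane of convergence.\<close>

lemma zeta_series_swap:
  assumes z: "cmod z < 1" and r: "r \<ge> 1" and m: "m \<ge> 1" and rm: "2 \<le> m * r"
  shows "(\<lambda>n. \<Sum>k. (- ((z / of_nat (Suc n)) ^ r)) ^ (k + m) / of_nat (k + m)) sums
           (\<Sum>k. zeta (of_nat ((k + m) * r)) * ((- (z ^ r)) ^ (k + m) / of_nat (k + m)))"
proof -
  define f where "f n k = (- ((z / of_nat (Suc n)) ^ r)) ^ (k + m) / of_nat (k + m)" for n k
  have pow_pow: "(x ^ r) ^ k = x ^ (k * r)" for x :: complex and k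
    by (simp add: power_mult[symmetric] mult.commute)
  have pow_pow_real: "(x ^ r) ^ k = x ^ (k * r)" for x :: real and k
    by (simp add: power_mult[symmetric] mult.commute)
  have f_eq: "f n k = 1 / of_nat (Suc n) ^ ((k + m) * r) * ((- (z ^ r)) ^ (k + m) / of_nat (k + m))"
    for n k
  proof -
    have *: "- ((z / of_nat (Suc n)) ^ r) = - (z ^ r) / of_nat (Suc n) ^ r"
      by (simp only: power_divide minus_divide_left)
    show ?thesis
      unfolding f_def * by (simp only: power_divide pow_pow) simp
  qed
  have s2: "summable (\<lambda>n. 1 / real (Suc n) ^ 2)"
    using inverse_power_summable[of 2, where 'a=real]
    by (subst summable_Suc_iff) (simp add: field_simps)
  have exp_ge: "2 \<le> (k + m) * r" for k
    using rm by (simp add: algebra_simps)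
  have pow_le: "1 / real (Suc n) ^ ((k + m) * r) \<le> 1 / real (Suc n) ^ 2" for n k
    using exp_ge by (intro divide_left_mono power_increasing) (auto simp del: of_nat_Suc)
  have "(\<lambda>n. \<Sum>k. f n k) sums (\<Sum>k. \<Sum>n. f n k)"
  proof (rule sums_suminf_swap)
    show "summable (\<lambda>n. 1 / real (Suc n) ^ 2)"
      by fact
    show "summable (\<lambda>k. cmod z ^ k)"
      using z by (intro summable_geometric) simp
    \<comment> \<open>The term separates: the power of \<open>Suc n\<close> is bounded through its
      exponent being at least 2, and the power of \<open>cmod z\<close> through its exponent being
      at least \<open>k\<close>.\<close>
    show "norm (f n k) \<le> 1 / real (Suc n) ^ 2 * cmod z ^ k" for n k
    proof -
      have "k * 1 \<le> (k + m) * r"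
        using r by (intro mult_le_mono) auto
      then have "cmod z ^ ((k + m) * r) \<le> cmod z ^ k"
        using z by (intro power_decreasing) auto
      moreover have "cmod z ^ ((k + m) * r) / real (k + m) \<le> cmod z ^ ((k + m) * r)"
        using m by (simp add: divide_le_eq mult_le_cancel_left1)
      ultimately have "cmod z ^ ((k + m) * r) / real (k + m) \<le> cmod z ^ k"
        by linarith
      moreover have "norm (f n k) =
          1 / real (Suc n) ^ ((k + m) * r) * (cmod z ^ ((k + m) * r) / real (k + m))"
        by (simp add: f_eq norm_mult norm_divide norm_power pow_pow_real del: of_nat_Suc of_nat_add)
      ultimately show ?thesis
        using mult_mono[OF pow_le[of n k], of "cmod z ^ ((k + m) * r) / real (k + m)" "cmod z ^ k"]
        by (simp del: of_nat_Suc of_nat_add)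
    qed
  qed auto
  moreover have "(\<Sum>n. f n k) =
      zeta (of_nat ((k + m) * r)) * ((- (z ^ r)) ^ (k + m) / of_nat (k + m))" for k
  proof -
    have "summable (\<lambda>n. norm (1 / of_nat (Suc n) ^ ((k + m) * r) :: complex))"
      by (rule summable_comparison_test'[OF s2, of 0])
        (use pow_le in \<open>simp add: norm_divide norm_power del: of_nat_Suc\<close>)
    then show ?thesis
      unfolding f_eq zeta_of_nat by (rule suminf_mult2[OF summable_norm_cancel, symmetric])
  qed
  ultimately show ?thesis
    by (simp add: f_def)
qed

section \<open>Logarithmic series for \<open>ell\<close>\<close>

text \<open>For fixed n the inner series is the Taylor series of \<open>ln (1 + x)\<close> at
  \<open>x = z / n\<close> without its linear term, because the zeta series starts at exponent 2.
  The missing term is the Weierstrass correction.\<close>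

lemma ell_1_sums:
  assumes z: "cmod z < 1"
  shows "(\<lambda>n. ln (1 + z / of_nat (Suc n)) - z / of_nat (Suc n)) sums (ell 1 z - euler_mascheroni * z)"
proof -
  have inner: "(\<Sum>k. (- x) ^ (k + 2) / of_nat (k + 2)) = - (ln (1 + x) - x)"
    if "cmod x < 1" for x
  proof -
    \<comment> \<open>The logarithm series is indexed from 0, where division by 0 makes the term 0;
      dropping two terms thus removes exactly \<open>x\<close>.\<close>
    have "(\<lambda>n. - ((- x) ^ (n + 2)) / of_nat (n + 2)) sums (ln (1 + x) - x)"
      using sums_split_initial_segment[OF Ln_series'[OF that], of 2] by (simp add: numeral_2_eq_2)
    from sums_unique[OF sums_minus[OF this]] show ?thesis
      by simp
  qed
  have "(\<lambda>n. - (ln (1 + z / of_nat (Suc n)) - z / of_nat (Suc n))) sums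
      (\<Sum>k. zeta (of_nat (k + 2)) * ((- z) ^ (k + 2) / of_nat (k + 2)))"
    using zeta_series_swap[OF z, of 1 2] inner[OF norm_div_Suc_less_1[OF z]]
    by (simp del: of_nat_Suc of_nat_add add_2_eq_Suc')
  from sums_minus[OF this] show ?thesis
    by (simp add: ell_def del: of_nat_Suc of_nat_add add_2_eq_Suc')
qed

text \<open>The same exchange with \<open>x = (z / n) ^ r\<close>. For \<open>r \<ge> 2\<close> the
  logarithms are already summable, so no linear correction appears.\<close>

lemma ell_sums:
  assumes z: "cmod z < 1" and r: "r \<ge> 2"
  shows "(\<lambda>n. ln (1 + (z / of_nat (Suc n)) ^ r)) sums ell r z"
proof -
  have inner: "(\<Sum>k. (- x) ^ (k + 1) / of_nat (k + 1)) = - ln (1 + x)"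
    if "cmod x < 1" for x
  proof -
    have "(\<lambda>n. - ((- x) ^ (n + 1)) / of_nat (n + 1)) sums ln (1 + x)"
      using sums_split_initial_segment[OF Ln_series'[OF that], of 1] by simp
    from sums_unique[OF sums_minus[OF this]] show ?thesis
      by simp
  qed
  have "cmod ((z / of_nat (Suc n)) ^ r) < 1" for n
    using norm_div_Suc_less_1[OF z, of n] r
    by (simp add: norm_power power_less_one_iff del: of_nat_Suc)
  then have "(\<lambda>n. - ln (1 + (z / of_nat (Suc n)) ^ r)) sums
      (\<Sum>k. zeta (of_nat ((k + 1) * r)) * ((- (z ^ r)) ^ (k + 1) / of_nat (k + 1)))"
    using zeta_series_swap[OF z, of r 1] inner r
    by (simp del: of_nat_Suc of_nat_add Suc_eq_plus1 add_Suc_right power_Suc)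
  from sums_minus[OF this] show ?thesis
    using r by (simp add: ell_def del: of_nat_Suc of_nat_add)
qed

section \<open>The Weierstrass series of \<open>ln_Gamma\<close>\<close>

text \<open>This is the logarithm of the Weierstrass product, with the branch controlled. The
  partial sums are compared with \<open>ln_Gamma_series\<close>, which converges to
  \<open>ln_Gamma\<close>; \<open>h\<close> tends to Euler's constant and \<open>d\<close> to
  0.\<close>

lemma ln_Gamma_plus1_sums:
  fixes z :: complex
  assumes z: "cmod z < 1"
  shows "(\<lambda>n. z / of_nat (Suc n) - ln (1 + z / of_nat (Suc n))) sums
           (ln_Gamma (1 + z) + euler_mascheroni * z)"
proof -
  define S where "S n = (\<Sum>k<n. z / of_nat (Suc k) - ln (1 + z / of_nat (Suc k)))" for n
  define d where "d n = complex_of_real (ln (real (Suc n)) - ln (real n))" for n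
  define h where "h n = complex_of_real (harm n - ln (real n))" for n
  have ne: "1 + z / of_nat k \<noteq> 0" if "k > 0" for k
  proof
    assume "1 + z / of_nat k = 0"
    then have "z = - of_nat k"
      using that by (simp add: field_simps add_eq_0_iff)
    then have "cmod z = real k"
      by simp
    then show False
      using z that by simp
  qed
  have nz: "1 + z \<notin> \<int>\<^sub>\<le>\<^sub>0"
    using one_plus_notin_nonpos_Reals[OF z] nonpos_Ints_subset_nonpos_Reals by auto
  \<comment> \<open>Since \<open>(k + 1) / k\<close> is positive, the logarithm of the product stays on the principal branch.\<close>
  have ln_shift: "ln ((1 + z) / of_nat k + 1) =
      ln (1 + z / of_nat (Suc k)) + complex_of_real (ln (real (Suc k)) - ln (real k))" if "k > 0" for k
  proof -
    have "(1 + z) / of_nat k + 1 = complex_of_real (real (Suc k) / real k) * (1 + z / of_nat (Suc k))"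
      using that by (simp add: divide_simps algebra_simps del: of_nat_Suc) (simp add: algebra_simps)
    also have "ln \<dots> = complex_of_real (ln (real (Suc k) / real k)) + ln (1 + z / of_nat (Suc k))"
      using that ne[of "Suc k"] Ln_times_of_real[of "real (Suc k) / real k"]
        Ln_of_real[of "real (Suc k) / real k"]
      by (simp del: of_nat_Suc of_real_divide of_real_of_nat_eq)
    finally show ?thesis
      using that by (simp add: ln_div del: of_nat_Suc)
  qed
  \<comment> \<open>\<open>ln_Gamma_series (1 + z) n\<close> contains \<open>n + 1\<close>
    logarithms, counting \<open>ln (1 + z)\<close>, hence the shift to \<open>Suc n\<close>. The
    extra \<open>d n\<close> come from replacing \<open>ln (n + 1)\<close> by
    \<open>ln n\<close>.\<close>
  have "S (Suc n) = ln_Gamma_series (1 + z) n + z * (h (Suc n) + d n) + d n" if "n > 0" for n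
  proof -
    have "(\<Sum>k=1..n. ln ((1 + z) / of_nat k + 1)) =
        (\<Sum>k=1..n. ln (1 + z / of_nat (Suc k)) + complex_of_real (ln (real (Suc k)) - ln (real k)))"
      by (intro sum.cong refl ln_shift) auto
    also have "\<dots> = (\<Sum>k=1..n. ln (1 + z / of_nat (Suc k))) +
        complex_of_real (\<Sum>k=1..n. ln (real (Suc k)) - ln (real k))"
      by (simp add: sum.distrib del: of_nat_Suc)
    also have "(\<Sum>k=1..n. ln (real (Suc k)) - ln (real k)) = ln (real (Suc n))"
      using sum_Suc_diff[of 1 n "\<lambda>k. ln (real k)"] by simp
    finally have A: "(\<Sum>k=1..n. ln ((1 + z) / of_nat k + 1)) =
        (\<Sum>k=1..n. ln (1 + z / of_nat (Suc k))) + complex_of_real (ln (real (Suc n)))" .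
    have B: "(\<Sum>k<Suc n. ln (1 + z / of_nat (Suc k))) =
        ln (1 + z) + (\<Sum>k=1..n. ln (1 + z / of_nat (Suc k)))"
      by (simp add: lessThan_Suc_atMost atMost_atLeast0 sum.atLeast_Suc_atMost[of 0] del: of_nat_Suc)
        simp
    have C: "(\<Sum>k<Suc n. z / of_nat (Suc k)) = z * of_real (harm (Suc n))"
      unfolding harm_def
      by (simp add: sum_distrib_left distrib_left sum.atLeast1_atMost_eq divide_inverse del: of_nat_Suc)
    have D: "ln (of_nat n :: complex) = complex_of_real (ln (real n))"
      using that Ln_of_real[of "real n"] by simp
    show ?thesis
      unfolding S_def ln_Gamma_series_def sum_subtractf A B C D h_def d_def
      by (simp add: algebra_simps del: of_nat_Suc sum.lessThan_Suc)
  qed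
  then have ev: "eventually (\<lambda>n. ln_Gamma_series (1 + z) n + z * (h (Suc n) + d n) + d n = S (Suc n))
      sequentially"
    by (intro eventually_mono[OF eventually_gt_at_top[of 0]]) auto
  have d0: "d \<longlonglongrightarrow> 0"
  proof -
    have "(\<lambda>n. ln (1 + 1 / real n)) \<longlonglongrightarrow> ln (1 + 0)"
      by (intro tendsto_intros lim_1_over_n) auto
    moreover have "eventually (\<lambda>n. ln (1 + 1 / real n) = ln (real (Suc n)) - ln (real n)) sequentially"
      using eventually_gt_at_top[of 0]
    proof eventually_elim
      case (elim n)
      then have "1 + 1 / real n = real (Suc n) / real n"
        by (simp add: add_divide_distrib)
      then show ?case
        using elim by (simp add: ln_div del: of_nat_Suc)
    qed
    ultimately have "(\<lambda>n. ln (real (Suc n)) - ln (real n)) \<longlonglongrightarrow> ln (1 + 0)"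
      by (rule Lim_transform_eventually)
    from tendsto_of_real[OF this, where 'a=complex] show ?thesis
      unfolding d_def by simp
  qed
  have h0: "(\<lambda>n. h (Suc n)) \<longlonglongrightarrow> euler_mascheroni"
    unfolding h_def by (rule LIMSEQ_Suc[OF euler_mascheroni_LIMSEQ_of_real])
  have "(\<lambda>n. ln_Gamma_series (1 + z) n + z * (h (Suc n) + d n) + d n) \<longlonglongrightarrow>
      ln_Gamma (1 + z) + z * (euler_mascheroni + 0) + 0"
    by (intro tendsto_intros ln_Gamma_complex_LIMSEQ nz d0 h0)
  then have "(\<lambda>n. S (Suc n)) \<longlonglongrightarrow> ln_Gamma (1 + z) + z * (euler_mascheroni + 0) + 0"
    by (rule Lim_transform_eventually[OF _ ev])
  then have "S \<longlonglongrightarrow> ln_Gamma (1 + z) + z * (euler_mascheroni + 0) + 0"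
    by (rule LIMSEQ_imp_Suc)
  then show ?thesis
    unfolding sums_def S_def by (simp add: mult.commute del: of_nat_Suc)
qed

text \<open>The two series are termwise negatives of each other. Being an equality of logarithms and
  not just of exponentials, this settles the branch for every \<open>r\<close>.\<close>

lemma ell_1_eq_ln_Gamma:
  assumes z: "cmod z < 1"
  shows "ell 1 z = - ln_Gamma (1 + z)"
proof -
  have "(\<lambda>n. z / of_nat (Suc n) - ln (1 + z / of_nat (Suc n))) sums - (ell 1 z - euler_mascheroni * z)"
    using sums_minus[OF ell_1_sums[OF z]] by (simp del: of_nat_Suc One_nat_def)
  from sums_unique2[OF this ln_Gamma_plus1_sums[OF z]] show ?thesis
    by (simp add: eq_neg_iff_add_eq_0 algebra_simps del: One_nat_def)
qed

lemma exp_ell_1: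
  assumes z: "cmod z < 1"
  shows "exp (ell 1 z) = inverse (Gamma (1 + z))"
  using ln_Gamma_branch(2)[of z] z by (simp add: ell_1_eq_ln_Gamma[OF z] exp_minus del: One_nat_def)

section \<open>Signed roots of unity and their factorization\<close>

lemma finite_signed_unity_roots: "r \<ge> 1 \<Longrightarrow> finite (signed_unity_roots r)"
  unfolding signed_unity_roots_def by (intro finite_nth_roots) auto

lemma norm_signed_unity_root:
  assumes "r \<ge> 1" "\<xi> \<in> signed_unity_roots r"
  shows "cmod \<xi> = 1"
proof -
  have "cmod \<xi> ^ r = 1"
    using assms by (simp add: signed_unity_roots_def flip: norm_power) (simp add: norm_power)
  then show ?thesis
    using assms(1) power_eq_1_iff[of "cmod \<xi>" r] by auto
qed

lemma signed_unity_roots_1: "signed_unity_roots 1 = {1}"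
  by (auto simp: signed_unity_roots_def)

lemma sum_signed_unity_roots: "r \<ge> 2 \<Longrightarrow> \<Sum>(signed_unity_roots r) = 0"
  unfolding signed_unity_roots_def by (rule sum_nth_roots) auto

text \<open>The monic polynomial \<open>x ^ r - c\<close> has only simple roots: its derivative can
  vanish only at 0, which is not a root since \<open>c \<noteq> 0\<close>. Hence it is the product
  of its distinct linear factors.\<close>

lemma prod_diff_nth_roots:
  fixes c x :: complex
  assumes r: "r \<ge> 1" and c: "c \<noteq> 0"
  shows "(\<Prod>\<xi> | \<xi> ^ r = c. x - \<xi>) = x ^ r - c"
proof -
  define p where "p = monom 1 r - [:c:]"
  have poly_p: "poly p a = a ^ r - c" for a
    by (simp add: p_def poly_monom)
  have "poly (pderiv p) a = of_nat r * a ^ (r - 1)" for a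
    by (simp add: p_def pderiv_diff pderiv_monom poly_monom pderiv_pCons)
  then have "rsquarefree p"
    unfolding rsquarefree_roots poly_p using r c by (auto simp: power_0_left)
  then have "smult (lead_coeff p) (\<Prod>z|poly p z = 0. [:-z, 1:]) = p"
    by (rule complex_poly_decompose_rsquarefree)
  moreover have "lead_coeff p = 1"
  proof -
    have "degree p = r"
      unfolding p_def using r
      by (subst diff_conv_add_uminus, subst degree_add_eq_left) (auto simp: degree_monom_eq)
    then show ?thesis
      using r by (simp add: p_def coeff_pCons split: nat.splits)
  qed
  ultimately have "poly (\<Prod>z|poly p z = 0. [:-z, 1:]) x = poly p x"
    by simp
  then show ?thesis
    by (simp add: poly_prod poly_p)
qed

text \<open>Evaluate the factorization of \<open>x ^ r - (- 1) ^ (r - 1)\<close> at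
  \<open>x = - 1 / w\<close> and pull \<open>- w\<close> out of each of the \<open>r\<close>
  factors.\<close>

lemma prod_signed_unity_roots:
  assumes r: "r \<ge> 1"
  shows "(\<Prod>\<xi>\<in>signed_unity_roots r. 1 + \<xi> * w) = 1 + w ^ r"
proof (cases "w = 0")
  case False
  have card: "card (signed_unity_roots r) = r"
    unfolding signed_unity_roots_def using r by (intro card_nth_roots) auto
  have "(\<Prod>\<xi>\<in>signed_unity_roots r. 1 + \<xi> * w) = (\<Prod>\<xi>\<in>signed_unity_roots r. (- w) * (- 1 / w - \<xi>))"
    using False by (intro prod.cong) (auto simp: field_simps)
  also have "\<dots> = (- w) ^ r * ((- 1 / w) ^ r - (- 1) ^ (r - 1))"
    unfolding prod.distrib prod_constant card
    using prod_diff_nth_roots[OF r, of "(- 1) ^ (r - 1)" "- 1 / w"]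
    by (simp only: signed_unity_roots_def) simp
  also have "\<dots> = (- w * (- 1 / w)) ^ r - (- 1) ^ (r + (r - 1)) * w ^ r"
    by (simp only: right_diff_distrib power_mult_distrib power_minus[of w] power_add mult_ac)
  \<comment> \<open>The exponent \<open>r + (r - 1)\<close> is odd, so the sign becomes plus for
    either parity of \<open>r\<close>; this explains the sign in
    \<open>signed_unity_roots\<close>.\<close>
  also have "\<dots> = 1 + w ^ r"
    using False r by (simp add: minus_one_power_iff)
  finally show ?thesis .
qed (use r in auto)

text \<open>Both sides have the same exponential, so their difference has vanishing derivative.\<close>

lemma sum_ln_signed_unity_roots:
  assumes r: "r \<ge> 1" and w: "cmod w < 1"
  shows "(\<Sum>\<xi>\<in>signed_unity_roots r. ln (1 + \<xi> * w)) = ln (1 + w ^ r)"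
proof -
  define h where "h w = (\<Sum>\<xi>\<in>signed_unity_roots r. ln (1 + \<xi> * w)) - ln (1 + w ^ r)" for w :: complex
  have small: "cmod (\<xi> * x) < 1" if "cmod x < 1" "\<xi> \<in> signed_unity_roots r" for x \<xi>
    using that norm_signed_unity_root[OF r] by (simp add: norm_mult)
  have small': "cmod (x ^ r) < 1" if "cmod x < 1" for x
    using that r by (simp add: norm_power power_less_one_iff)
  have ne: "1 + y \<noteq> 0" if "cmod y < 1" for y
    using one_plus_notin_nonpos_Reals[OF that] by auto
  have exp_h: "exp (h x) = 1" if "cmod x < 1" for x
    using that ne small small' prod_signed_unity_roots[OF r, of x]
    by (simp add: h_def exp_diff exp_sum finite_signed_unity_roots[OF r] cong: prod.cong)
  have "h holomorphic_on ball 0 1"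
    unfolding h_def using small small' one_plus_notin_nonpos_Reals
    by (intro holomorphic_intros) auto
  then have deriv: "(h has_field_derivative deriv h x) (at x)" if "cmod x < 1" for x
    using that by (intro holomorphic_derivI[of h "ball 0 1" x]) auto
  have deriv_0: "deriv h x = 0" if x: "cmod x < 1" for x
  proof -
    have "((\<lambda>x. exp (h x)) has_field_derivative exp (h x) * deriv h x) (at x)"
      by (rule DERIV_fun_exp[OF deriv[OF x]])
    moreover have "((\<lambda>x. exp (h x)) has_field_derivative 0) (at x)"
    proof (rule has_field_derivative_transform_within_open)
      show "((\<lambda>x. 1) has_field_derivative 0) (at x)"
        by simp
    qed (use x exp_h in \<open>auto intro: open_ball[of 0 1]\<close>)
    ultimately have "exp (h x) * deriv h x = 0"
      by (rule DERIV_unique)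
    then show ?thesis
      by simp
  qed
  have "\<exists>c. \<forall>x\<in>ball 0 1. h x = c"
  proof (intro has_field_derivative_zero_constant)
    fix x :: complex assume "x \<in> ball 0 1"
    then have "(h has_field_derivative 0) (at x)"
      using deriv[of x] deriv_0[of x] by simp
    then show "(h has_field_derivative 0) (at x within ball 0 1)"
      by (rule has_field_derivative_at_within)
  qed simp
  then have "h w = h 0"
    using w by auto
  also have "h 0 = 0"
    using r by (simp add: h_def power_0_left)
  finally show ?thesis
    by (simp add: h_def)
qed

section \<open>Reduction to \<open>ell 1\<close> and infinite products\<close>

lemma ell_eq_sum_ell_1:
  assumes r: "r \<ge> 1" and z: "cmod z < 1"
  shows "ell r z = (\<Sum>\<xi>\<in>signed_unity_roots r. ell 1 (\<xi> * z))"
proof (cases "r = 1")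
  case True
  then show ?thesis
    by (simp add: signed_unity_roots_1[simplified])
next
  case False
  with r have r2: "r \<ge> 2"
    by simp
  \<comment> \<open>Used twice: it cancels the corrections \<open>z / n\<close> inside the series
    and the terms with Euler's constant outside it.\<close>
  have lin: "(\<Sum>\<xi>\<in>signed_unity_roots r. \<xi> * c) = 0" for c
    using sum_signed_unity_roots[OF r2] by (simp flip: sum_distrib_right)
  have "(\<lambda>n. \<Sum>\<xi>\<in>signed_unity_roots r. ln (1 + \<xi> * z / of_nat (Suc n)) - \<xi> * z / of_nat (Suc n)) sums
      (\<Sum>\<xi>\<in>signed_unity_roots r. ell 1 (\<xi> * z) - euler_mascheroni * (\<xi> * z))"
    using z by (intro sums_sum ell_1_sums) (simp add: norm_mult norm_signed_unity_root[OF r])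
  moreover have "(\<Sum>\<xi>\<in>signed_unity_roots r. ln (1 + \<xi> * z / of_nat (Suc n)) - \<xi> * z / of_nat (Suc n)) =
      ln (1 + (z / of_nat (Suc n)) ^ r)" for n
    using sum_ln_signed_unity_roots[OF r norm_div_Suc_less_1[OF z, of n]]
      lin[of "z / of_nat (Suc n)"]
    by (simp add: sum_subtractf del: of_nat_Suc)
  moreover have "(\<Sum>\<xi>\<in>signed_unity_roots r. ell 1 (\<xi> * z) - euler_mascheroni * (\<xi> * z)) =
      (\<Sum>\<xi>\<in>signed_unity_roots r. ell 1 (\<xi> * z))"
    using lin[of "euler_mascheroni * z"] by (simp add: sum_subtractf mult_ac)
  ultimately have "(\<lambda>n. ln (1 + (z / of_nat (Suc n)) ^ r)) sums
      (\<Sum>\<xi>\<in>signed_unity_roots r. ell 1 (\<xi> * z))"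
    by simp
  then show ?thesis
    using ell_sums[OF z r2] sums_unique2 by blast
qed

text \<open>Apart from \<open>r = 1\<close>, where the only root is 1, \<open>ell r z\<close>
  depends on \<open>z\<close> only through \<open>z ^ r\<close>.\<close>

lemma ell_mult_unity_root:
  assumes "\<xi> \<in> unity_roots r"
  shows "ell r (\<xi> * z) = ell r z"
  using assms by (cases "r = 1") (auto simp: unity_roots_def ell_def power_mult_distrib)

text \<open>Exponentiation turns the series of \<open>ell 1\<close> into a product; no factor
  vanishes in the unit disc, so \<open>exp\<close> undoes \<open>ln\<close>. The form
  \<open>has_prod\<close> yields both convergence and value.\<close>

lemma has_prod_weierstrass_factors:
  assumes w: "cmod w < 1"
  shows "(\<lambda>n. (1 + w / of_nat (Suc n)) * exp (- w / of_nat (Suc n))) has_prod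
           exp (ell 1 w - euler_mascheroni * w)"
proof -
  have "1 + w / of_nat (Suc n) \<noteq> 0" for n
    using one_plus_notin_nonpos_Reals[OF norm_div_Suc_less_1[OF w, of n]] by auto
  then have "exp (ln (1 + w / of_nat (Suc n)) - w / of_nat (Suc n)) =
      (1 + w / of_nat (Suc n)) * exp (- w / of_nat (Suc n))" for n
    by (simp add: exp_diff exp_minus divide_inverse del: of_nat_Suc)
  then show ?thesis
    using sums_imp_has_prod_exp[OF ell_1_sums[OF w]] by (simp add: has_prod_def del: of_nat_Suc)
qed

lemma has_prod_exp_ell:
  assumes z: "cmod z < 1" and r: "r \<ge> 2"
  shows "(\<lambda>n. 1 + z ^ r / of_nat (Suc n) ^ r) has_prod exp (ell r z)"
proof -
  have "cmod ((z / of_nat (Suc n)) ^ r) < 1" for n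
    using norm_div_Suc_less_1[OF z, of n] r
    by (simp add: norm_power power_less_one_iff del: of_nat_Suc)
  then have "1 + (z / of_nat (Suc n)) ^ r \<noteq> 0" for n
    using one_plus_notin_nonpos_Reals[of "(z / of_nat (Suc n)) ^ r"] by auto
  then show ?thesis
    using sums_imp_has_prod_exp[OF ell_sums[OF z r]]
    by (simp add: has_prod_def power_divide del: of_nat_Suc)
qed

theorem proposition2p7:
  shows
    "(\<forall>r\<ge>1.
        (\<forall>\<xi>\<in>unity_roots r. \<forall>z. cmod z < 1 \<longrightarrow>
           ell r z = ell r (\<xi> * z) \<and> exp (ell r z) = exp (ell r (\<xi> * z))) \<and>
        (even r \<longrightarrow> - 1 \<in> unity_roots r \<and>
           (\<forall>z. cmod z < 1 \<longrightarrow>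
              ell r (- z) = ell r z \<and> exp (ell r (- z)) = exp (ell r z)))) \<and>
     (\<forall>r\<ge>1. \<forall>z. cmod z < 1 \<longrightarrow>
        ell r z = - (\<Sum>\<xi>\<in>signed_unity_roots r. ln_Gamma (1 + \<xi> * z)) \<and>
        (\<forall>\<xi>\<in>signed_unity_roots r.
           convergent_prod (\<lambda>n. (1 + \<xi> * z / of_nat (Suc n)) * exp (- \<xi> * z / of_nat (Suc n)))) \<and>
        exp (ell r z) =
          (\<Prod>\<xi>\<in>signed_unity_roots r. exp (euler_mascheroni * \<xi> * z) *
             (\<Prod>n. (1 + \<xi> * z / of_nat (Suc n)) * exp (- \<xi> * z / of_nat (Suc n))))) \<and>
     (\<forall>r\<ge>2. odd r \<longrightarrow> (\<forall>z. cmod z < 1 \<longrightarrow>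
        inverse (Gamma_y r (1 + z)) = exp (ell r z) \<and>
        exp (ell r z) =
          inverse (Gamma (1 + z)) * (\<Prod>\<xi>\<in>signed_unity_roots r - {1}. exp (ell 1 (\<xi> * z))))) \<and>
     (\<forall>r\<ge>2. \<forall>z. cmod z < 1 \<longrightarrow>
        exp (ell r z) = (\<Prod>\<xi>\<in>signed_unity_roots r. exp (ell 1 (\<xi> * z))) \<and>
        convergent_prod (\<lambda>n. 1 + z ^ r / of_nat (Suc n) ^ r) \<and>
        exp (ell r z) = (\<Prod>n. 1 + z ^ r / of_nat (Suc n) ^ r))"
proof (intro conjI allI impI ballI)
  fix r :: nat and z \<xi> :: complex
  assume r: "r \<ge> 1" and z: "cmod z < 1"
  have small: "cmod (\<xi> * z) < 1" if "\<xi> \<in> signed_unity_roots r" for \<xi>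
    using that z r by (simp add: norm_mult norm_signed_unity_root)
  show "ell r z = - (\<Sum>\<xi>\<in>signed_unity_roots r. ln_Gamma (1 + \<xi> * z))"
    by (simp add: ell_eq_sum_ell_1[OF r z] ell_1_eq_ln_Gamma[OF small] sum_negf del: One_nat_def cong: sum.cong)
  show "convergent_prod (\<lambda>n. (1 + \<xi> * z / of_nat (Suc n)) * exp (- \<xi> * z / of_nat (Suc n)))"
    if "\<xi> \<in> signed_unity_roots r"
    using has_prod_weierstrass_factors[OF small[OF that]] by (simp add: has_prod_iff del: of_nat_Suc)
  \<comment> \<open>The prefactor cancels the term \<open>- euler_mascheroni * w\<close> in the
    exponent of the Weierstrass product at \<open>w = \<xi> * z\<close>.\<close>
  have "exp (euler_mascheroni * \<xi> * z) *
      (\<Prod>n. (1 + \<xi> * z / of_nat (Suc n)) * exp (- \<xi> * z / of_nat (Suc n))) = exp (ell 1 (\<xi> * z))"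
    if "\<xi> \<in> signed_unity_roots r" for \<xi>
    using has_prod_weierstrass_factors[OF small[OF that]]
    by (simp add: has_prod_iff exp_diff mult.assoc del: of_nat_Suc One_nat_def)
  then show "exp (ell r z) = (\<Prod>\<xi>\<in>signed_unity_roots r. exp (euler_mascheroni * \<xi> * z) *
      (\<Prod>n. (1 + \<xi> * z / of_nat (Suc n)) * exp (- \<xi> * z / of_nat (Suc n))))"
    by (simp add: ell_eq_sum_ell_1[OF r z] exp_sum finite_signed_unity_roots[OF r]
        del: of_nat_Suc One_nat_def cong: prod.cong)
next
  fix r :: nat and z :: complex
  assume r: "r \<ge> 2" and z: "cmod z < 1"
  then have r1: "r \<ge> 1"
    by simp
  show prod: "exp (ell r z) = (\<Prod>\<xi>\<in>signed_unity_roots r. exp (ell 1 (\<xi> * z)))"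
    by (simp only: ell_eq_sum_ell_1[OF r1 z] exp_sum finite_signed_unity_roots[OF r1])
  show "convergent_prod (\<lambda>n. 1 + z ^ r / of_nat (Suc n) ^ r)"
    "exp (ell r z) = (\<Prod>n. 1 + z ^ r / of_nat (Suc n) ^ r)"
    using has_prod_exp_ell[OF z r] by (simp_all add: has_prod_iff del: of_nat_Suc)
  show "inverse (Gamma_y r (1 + z)) = exp (ell r z)"
    by (simp add: Gamma_y_def exp_minus)
  assume "odd r"
  \<comment> \<open>For odd \<open>r\<close> the value \<open>(- 1) ^ (r - 1)\<close> is 1, so the
    factor at 1 can be split off and gives the reciprocal Gamma value.\<close>
  then have "1 \<in> signed_unity_roots r"
    by (simp add: signed_unity_roots_def)
  then show "exp (ell r z) =
      inverse (Gamma (1 + z)) * (\<Prod>\<xi>\<in>signed_unity_roots r - {1}. exp (ell 1 (\<xi> * z)))"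
    using prod exp_ell_1[OF z]
    by (simp add: prod.remove[OF finite_signed_unity_roots[OF r1]] del: One_nat_def)
next
  fix r :: nat and z :: complex
  assume "even r"
  then show "- 1 \<in> unity_roots r"
    by (simp add: unity_roots_def)
  from ell_mult_unity_root[OF this, of z]
  show "ell r (- z) = ell r z" "exp (ell r (- z)) = exp (ell r z)"
    by simp_all
qed (simp_all add: ell_mult_unity_root)

end
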